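(* Let $f$ be a tropical transcendental entire function, let $\alpha>0$ and $c\in\mathbb{R}$. Then the function $$f(x)^{\otimes\alpha}\otimes f(x+c)=\alpha f(x)+f(x+c)$$ has infinitely many roots.
   Context: A tropical meromorphic function is a continuous piecewise linear function $f:\mathbb{R}\to\mathbb{R}$ (arbitrary real slopes, points of slope change having no accumulation point in $\mathbb{R}$). For $x_0\in\mathbb{R}$ put $\omega_f(x_0)=\lim_{\varepsilon\to0^+}[f'(x_0+\varepsilon)-f'(x_0-\varepsilon)]$; $x_0$ is a root of $f$ if $\omega_f(x_0)>0$, and a pole if $\omega_f(x_0)<0$. A tropical entire function is a tropical meromorphic function without poles. A tropical polynomial is a tropical meromorphic function with finitely many roots and no poles; a tropical entire function is transcendental if it is not a tropical polynomial. Max-plus notation: $x\otimes y=x+y$, $x^{\otimes\alpha}=\alpha x$. *)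

theory Defs
  imports "HOL-Analysis.Analysis"
begin

(* S contains the points where the slope changes; it is closed and discrete, and f is affine
   on every open interval that avoids S. The last clause of the definition also covers the
   unbounded pieces, since a function that is affine on all bounded subintervals of an
   interval is affine on the interval. *)
definition tropical_meromorphic :: "(real \<Rightarrow> real) \<Rightarrow> bool" where
  "tropical_meromorphic f \<longleftrightarrow>
     continuous_on UNIV f \<and>
     (\<exists>S. (\<forall>x. \<not> x islimpt S) \<and>
          (\<forall>a b. {a<..<b} \<inter> S = {} \<longrightarrow>
             (\<exists>m k. \<forall>x\<in>{a<..<b}. f x = m * x + k)))"

(* The limit exists whenever f is tropical meromorphic: f' is constant on each side near x0. *)
definition tropical_omega :: "(real \<Rightarrow> real) \<Rightarrow> real \<Rightarrow> real" where
  "tropical_omega f x0 =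
     Lim (at_right 0) (\<lambda>\<epsilon>. deriv f (x0 + \<epsilon>) - deriv f (x0 - \<epsilon>))"

definition tropical_root :: "(real \<Rightarrow> real) \<Rightarrow> real \<Rightarrow> bool" where
  "tropical_root f x0 \<longleftrightarrow> tropical_omega f x0 > 0"

definition tropical_pole :: "(real \<Rightarrow> real) \<Rightarrow> real \<Rightarrow> bool" where
  "tropical_pole f x0 \<longleftrightarrow> tropical_omega f x0 < 0"

definition tropical_entire :: "(real \<Rightarrow> real) \<Rightarrow> bool" where
  "tropical_entire f \<longleftrightarrow> tropical_meromorphic f \<and> (\<forall>x. \<not> tropical_pole f x)"

definition tropical_polynomial :: "(real \<Rightarrow> real) \<Rightarrow> bool" where
  "tropical_polynomial f \<longleftrightarrow>
     tropical_meromorphic f \<and> finite {x. tropical_root f x} \<and> (\<forall>x. \<not> tropical_pole f x)"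

definition tropical_transcendental_entire :: "(real \<Rightarrow> real) \<Rightarrow> bool" where
  "tropical_transcendental_entire f \<longleftrightarrow> tropical_entire f \<and> \<not> tropical_polynomial f"

end

theory Submission
  imports Defs
begin

text \<open>On each side of a point, \<open>f\<close> is affine near it, so \<open>\<omega>\<close> is a difference of two slopes and
  hence satisfies \<open>\<omega>\<^sub>g(x) = \<alpha> \<omega>\<^sub>f(x) + \<omega>\<^sub>f(x + c)\<close> for \<open>g(x) = \<alpha> f(x) + f(x + c)\<close>. Without
  poles \<open>\<omega>\<^sub>f\<close> is nonnegative, so every root of \<open>f\<close> is a root of \<open>g\<close>.\<close>

lemma has_real_derivative_affine_on:
  fixes f :: "real \<Rightarrow> real"
  assumes "\<forall>x\<in>{a<..<b}. f x = m * x + k" and "y \<in> {a<..<b}"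
  shows "(f has_real_derivative m) (at y)"
proof -
  have "((\<lambda>x. m * x + k) has_real_derivative m) (at y)"
    by (auto intro!: derivative_eq_intros)
  then show ?thesis
    by (rule has_field_derivative_transform_within_open[of _ _ _ "{a<..<b}"]) (use assms in auto)
qed

text \<open>Since \<open>S\<close> does not accumulate at x, a punctured neighbourhood of x misses
  \<open>S\<close>, and f is affine on each half of it. The slopes are recorded at
  \<open>x + e\<close> and \<open>x - e\<close> to match the limit in
  \<open>tropical_omega\<close>.\<close>

lemma tropical_meromorphic_one_sided_slopes:
  assumes "tropical_meromorphic f"
  obtains l r where
    "eventually (\<lambda>e. (f has_real_derivative r) (at (x + e)) \<and>
                     (f has_real_derivative l) (at (x - e))) (at_right 0)"
proof -
  obtain S where S: "\<not> x islimpt S"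
    and aff: "\<And>a b. {a<..<b} \<inter> S = {} \<Longrightarrow> \<exists>m k. \<forall>x\<in>{a<..<b}. f x = m * x + k"
    using assms unfolding tropical_meromorphic_def by blast
  obtain d where d: "d > 0" "\<And>y. y \<in> S \<Longrightarrow> y \<noteq> x \<Longrightarrow> dist y x \<ge> d"
    using S unfolding islimpt_approachable by (meson not_le)
  \<comment> \<open>The point x itself may lie in \<open>S\<close>, so the two sides are separate
    open intervals with possibly different slopes.\<close>
  have "{x<..<x+d} \<inter> S = {}" "{x-d<..<x} \<inter> S = {}"
    using d(2) by (force simp: dist_real_def)+
  then obtain r k l k' where r: "\<forall>y\<in>{x<..<x+d}. f y = r * y + k"
    and l: "\<forall>y\<in>{x-d<..<x}. f y = l * y + k'"
    using aff by meson
  have "eventually (\<lambda>e. e \<in> {0<..<d}) (at_right 0)"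
    using d(1) by (rule eventually_at_right_real)
  then have "eventually (\<lambda>e. (f has_real_derivative r) (at (x + e)) \<and>
                     (f has_real_derivative l) (at (x - e))) (at_right 0)"
    by eventually_elim
      (auto intro: has_real_derivative_affine_on[OF r] has_real_derivative_affine_on[OF l])
  then show ?thesis by (rule that)
qed

text \<open>The expression under the limit is eventually constant. The derivatives in the hypothesis
  determine \<open>deriv\<close>, and uniqueness of limits along the nontrivial filter
  \<open>at_right 0\<close> determines \<open>Lim\<close>.\<close>

lemma tropical_omega_eq_slope_jump:
  assumes "eventually (\<lambda>e. (f has_real_derivative r) (at (x + e)) \<and>
                           (f has_real_derivative l) (at (x - e))) (at_right 0)"
  shows "tropical_omega f x = r - l"
proof -
  have "eventually (\<lambda>e. deriv f (x + e) - deriv f (x - e) = r - l) (at_right 0)"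
    using assms by eventually_elim (auto dest!: DERIV_imp_deriv)
  then have "((\<lambda>e. deriv f (x + e) - deriv f (x - e)) \<longlongrightarrow> r - l) (at_right 0)"
    by (rule tendsto_eventually)
  then show ?thesis
    unfolding tropical_omega_def by (intro tendsto_Lim) auto
qed

lemma tropical_omega_scaled_add_shift:
  assumes "tropical_meromorphic f"
  shows "tropical_omega (\<lambda>x. \<alpha> * f x + f (x + c)) x
       = \<alpha> * tropical_omega f x + tropical_omega f (x + c)"
proof -
  obtain l r where lr: "eventually (\<lambda>e. (f has_real_derivative r) (at (x + e)) \<and>
      (f has_real_derivative l) (at (x - e))) (at_right 0)"
    using tropical_meromorphic_one_sided_slopes[OF assms] .
  obtain l' r' where lr': "eventually (\<lambda>e. (f has_real_derivative r') (at (x + c + e)) \<and>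
      (f has_real_derivative l') (at (x + c - e))) (at_right 0)"
    using tropical_meromorphic_one_sided_slopes[OF assms] .
  \<comment> \<open>Translation does not change slopes: the slope of f at y + c is the slope at y of
    the shifted function.\<close>
  have sum: "((\<lambda>x. \<alpha> * f x + f (x + c)) has_real_derivative \<alpha> * m + m') (at y)"
    if "(f has_real_derivative m) (at y)" "(f has_real_derivative m') (at (y + c))" for m m' y
    using that by (intro DERIV_add DERIV_cmult) (simp_all add: DERIV_shift)
  have "eventually (\<lambda>e. ((\<lambda>x. \<alpha> * f x + f (x + c)) has_real_derivative \<alpha> * r + r') (at (x + e)) \<and>
      ((\<lambda>x. \<alpha> * f x + f (x + c)) has_real_derivative \<alpha> * l + l') (at (x - e))) (at_right 0)"
    \<comment> \<open>Both neighbourhood conditions hold for all small e > 0; rearranging turns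
      \<open>x + c + e\<close> into the form \<open>(x + e) + c\<close> that \<open>sum\<close>
      expects.\<close>
    using lr lr' by eventually_elim (intro conjI sum; simp add: algebra_simps)
  from tropical_omega_eq_slope_jump[OF this] show ?thesis
    by (simp add: tropical_omega_eq_slope_jump[OF lr] tropical_omega_eq_slope_jump[OF lr']
        right_diff_distrib)
qed

theorem theorem7p3:
  fixes f :: "real \<Rightarrow> real" and \<alpha> c :: real
  assumes "tropical_transcendental_entire f"
    and "\<alpha> > 0"
  shows "infinite {x. tropical_root (\<lambda>x. \<alpha> * f x + f (x + c)) x}"
proof -
  \<comment> \<open>Being meromorphic without poles, f can fail to be a polynomial only by having
    infinitely many roots.\<close>
  have mero: "tropical_meromorphic f" and nonneg: "\<And>x. tropical_omega f x \<ge> 0"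
    and inf: "infinite {x. tropical_root f x}"
    using assms(1)
    unfolding tropical_transcendental_entire_def tropical_entire_def tropical_polynomial_def
      tropical_pole_def by (auto simp: not_less)
  \<comment> \<open>At a root of f the term scaled by \<alpha> > 0 stays positive, and the
    nonnegative jump of f at x + c cannot cancel it.\<close>
  have "{x. tropical_root f x} \<subseteq> {x. tropical_root (\<lambda>x. \<alpha> * f x + f (x + c)) x}"
    using nonneg \<open>\<alpha> > 0\<close>
    by (auto simp: tropical_root_def tropical_omega_scaled_add_shift[OF mero]
        intro!: add_pos_nonneg)
  then show ?thesis
    using inf infinite_super by blast
qed

end
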